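(* Let $N\ge1$, $0<p<1$, $\mu<-\frac{2(p+1)}{(1-p)^2}$, and let $u$ be a nonnegative radial solution of $\Delta u+\frac{\mu}{\delta^2}u=u^p$ near the outer boundary $r=R$ of a ball or annulus, or near the inner boundary $r=r_0>0$ of an annulus. If $\lim_{\delta\to0}\frac{u(\delta)}{\delta^{\beta_-}}=0$, then $u\equiv0$ in a neighborhood of that boundary.
   Context: $\beta_-=\frac12-\sqrt{\frac14-\mu}$. The ball is $B_R=\{|x|<R\}\subset\mathbb{R}^N$, the annulus is $\{r_0<|x|<R\}$, and $\delta$ is the distance to the boundary: $\delta=R-r$ near the outer boundary, $\delta=r-r_0$ near the inner boundary, $r=|x|$. Radial solutions satisfy $u''+\frac{N-1}{r}u'+\frac{\mu}{\delta^2}u=u^p$ (derivatives in $r$); a solution near the boundary is one defined for $0<\delta<\delta_0$ for some $\delta_0>0$, regarded as a function of $\delta$. *)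

theory Defs
  imports "HOL-Analysis.Analysis"
begin

text \<open>On an open set \<open>S\<close>: \<open>f\<close> and all its first-order partial derivatives are (Frechet)
  differentiable. No continuity of the second derivatives is demanded, so every \<open>C\<^sup>2\<close> function
  qualifies.\<close>

definition twice_differentiable_on :: "('a::euclidean_space \<Rightarrow> real) \<Rightarrow> 'a set \<Rightarrow> bool" where
  "twice_differentiable_on f S \<longleftrightarrow>
     (\<forall>x\<in>S. f differentiable (at x)) \<and>
     (\<forall>b\<in>Basis. \<forall>x\<in>S. (\<lambda>y. frechet_derivative f (at y) b) differentiable (at x))"

definition laplacian :: "('a::euclidean_space \<Rightarrow> real) \<Rightarrow> 'a \<Rightarrow> real" where
  "laplacian f x =
     (\<Sum>b\<in>Basis. frechet_derivative (\<lambda>y. frechet_derivative f (at y) b) (at x) b)"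

text \<open>Nonnegative classical solutions of \<open>\<Delta>v + \<mu>/\<delta>\<^sup>2 v = v\<^sup>p\<close> on the open set \<open>S\<close>. Nonnegativity is
  part of the definition because \<open>powr\<close> is the intended power only for nonnegative base
  (\<open>0 powr p = 0\<close>, as it should be for \<open>p > 0\<close>).\<close>

definition nonneg_solution_on ::
    "real \<Rightarrow> real \<Rightarrow> ('a::euclidean_space \<Rightarrow> real) \<Rightarrow> 'a set \<Rightarrow> ('a \<Rightarrow> real) \<Rightarrow> bool" where
  "nonneg_solution_on \<mu> p \<delta> S v \<longleftrightarrow>
     twice_differentiable_on v S \<and>
     (\<forall>x\<in>S. 0 \<le> v x) \<and>
     (\<forall>x\<in>S. laplacian v x + \<mu> / (\<delta> x)\<^sup>2 * v x = v x powr p)"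

definition beta_minus :: "real \<Rightarrow> real" where
  "beta_minus \<mu> = 1/2 - sqrt (1/4 - \<mu>)"

end

theory Submission imports Defs begin

text \<open>A radial solution satisfies \<open>u'' + a u' + \<mu> u / t\<^sup>2 = u\<^sup>p\<close> in the distance \<open>t\<close> to the boundary, with a
  bounded coefficient \<open>a\<close>. Write \<open>b = \<beta>\<^sub>-\<close>; the other root of \<open>x\<^sup>2 - x + \<mu>\<close> is \<open>1 - b\<close>, and the hypothesis on
  \<open>\<mu>\<close> says that \<open>2 / (1 - p) < 1 - b\<close>. Since \<open>u = o(t\<^sup>b)\<close>, comparison of the linear subsolution \<open>u\<close>
  with \<open>C t\<^sup>\<beta> + \<epsilon> (t\<^sup>b + t\<^bsup>b+1/2\<^esup>)\<close> as \<open>\<epsilon> \<rightarrow> 0\<close> yields \<open>u = O(t\<^sup>\<beta>)\<close> for every \<open>\<beta> < 1 - b\<close>, in particular for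
  some \<open>\<beta> > 2 / (1 - p)\<close>. Then \<open>u\<close> is too small to reach, at the ends of \<open>[\<tau>/2, 3\<tau>/2]\<close>, the
  dead-core barrier \<open>A |t - \<tau>|\<^bsup>2/(1-p)\<^esup>\<close>, which forces \<open>u \<tau> = 0\<close> for all small \<open>\<tau>\<close>.\<close>

section \<open>Maximum principle on an interval\<close>

text \<open>A positive maximum would be interior and critical, where \<open>convex\<close>
  contradicts maximality. In the comparisons below \<open>z\<close> is the solution minus a barrier.
  Since \<open>convex\<close> concerns only critical points, the first-order terms of the solution
  and the barrier agree there and cancel.\<close>

lemma nonpos_of_no_positive_max:
  fixes z z' z'' :: "real \<Rightarrow> real"
  assumes z: "\<And>t. \<lbrakk>l \<le> t; t \<le> r\<rbrakk> \<Longrightarrow> (z has_real_derivative z' t) (at t)"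
    and z': "\<And>t. \<lbrakk>l \<le> t; t \<le> r\<rbrakk> \<Longrightarrow> (z' has_real_derivative z'' t) (at t)"
    and ends: "z l \<le> 0" "z r \<le> 0"
    and convex: "\<And>t. \<lbrakk>l < t; t < r; 0 < z t; z' t = 0\<rbrakk> \<Longrightarrow> 0 < z'' t"
    and t: "l \<le> t" "t \<le> r"
  shows "z t \<le> 0"
proof (rule ccontr)
  assume "\<not> z t \<le> 0"
  have "continuous_on {l..r} z"
    by (meson DERIV_isCont atLeastAtMost_iff continuous_at_imp_continuous_on z)
  then obtain m where m: "m \<in> {l..r}" and max: "\<And>y. y \<in> {l..r} \<Longrightarrow> z y \<le> z m"
    using t continuous_attains_sup[of "{l..r}" z] by auto
  have pos: "0 < z m"
    using max[of t] t \<open>\<not> z t \<le> 0\<close> by auto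
  then have m': "l < m" "m < r"
    using m ends by (auto simp: less_le)
  have crit: "z' m = 0"
  proof (rule DERIV_local_max)
    show "(z has_real_derivative z' m) (at m)" using z m by auto
    show "0 < min (m - l) (r - m)" using m' by auto
    show "\<forall>y. \<bar>m - y\<bar> < min (m - l) (r - m) \<longrightarrow> z y \<le> z m"
      by (intro allI impI max) (auto simp: abs_less_iff)
  qed
  \<comment> \<open>\<open>z''\<close> need not be continuous, so only its value at \<open>m\<close>
    is used: it makes \<open>z'\<close> positive just to the right of \<open>m\<close>, and the mean
    value theorem then yields a larger value of \<open>z\<close>.\<close>
  have "0 < z'' m" using convex m' pos crit by auto
  then obtain d where d: "d > 0" "\<And>h. \<lbrakk>0 < h; h < d\<rbrakk> \<Longrightarrow> 0 < z' (m + h)"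
    using DERIV_pos_inc_right[OF z'[of m]] m crit by auto
  define e where "e = min (d/2) (r - m)"
  have e: "0 < e" "e < d" "m + e \<le> r" using d m' by (auto simp: e_def)
  obtain y where y: "m < y" "y < m + e" "z (m + e) - z m = (m + e - m) * z' y"
    using MVT2[of m "m + e" z z'] z m' e by force
  have "0 < z' y" using d(2)[of "y - m"] y e by auto
  then have "z m < z (m + e)" using y(3) e by (simp add: algebra_simps)
  then show False using max[of "m + e"] m' e by auto
qed

section \<open>Improved decay from the linear equation\<close>

text \<open>Powers with exponent strictly between the roots \<open>b\<close> and
  \<open>1 - b\<close> are strict supersolutions of the Euler operator
  \<open>y'' - (b\<^sup>2 - b) / t\<^sup>2 * y\<close>, and near 0 the drift \<open>a\<close> is of
  lower order. The singular power \<open>t powr b\<close> dominates \<open>u\<close> at the left end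
  and carries an arbitrarily small factor.\<close>

lemma bound_of_little_o_beta_minus:
  fixes u u' u'' a :: "real \<Rightarrow> real" and b :: real
  assumes d: "0 < d"
    and u: "\<And>t. \<lbrakk>0 < t; t < d\<rbrakk> \<Longrightarrow> (u has_real_derivative u' t) (at t)"
    and u': "\<And>t. \<lbrakk>0 < t; t < d\<rbrakk> \<Longrightarrow> (u' has_real_derivative u'' t) (at t)"
    and sub: "\<And>t. \<lbrakk>0 < t; t < d\<rbrakk> \<Longrightarrow> (b\<^sup>2 - b) / t\<^sup>2 * u t \<le> u'' t + a t * u' t"
    and a: "\<And>t. \<lbrakk>0 < t; t < d\<rbrakk> \<Longrightarrow> \<bar>a t\<bar> \<le> K"
    and nonneg: "\<And>t. \<lbrakk>0 < t; t < d\<rbrakk> \<Longrightarrow> 0 \<le> u t"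
    and lim: "((\<lambda>t. u t / t powr b) \<longlongrightarrow> 0) (at_right 0)"
    and b: "b < 0" and \<beta>: "0 < \<beta>" "\<beta> < 1 - b"
  obtains C e where "0 \<le> C" "0 < e" "e < d" "\<And>t. \<lbrakk>0 < t; t \<le> e\<rbrakk> \<Longrightarrow> u t \<le> C * t powr \<beta>"
proof -
  \<comment> \<open>The Euler operator maps \<open>s powr \<beta>\<close> to
    \<open>- c * s powr (\<beta> - 2)\<close>; \<open>c\<close> is the margin that has to absorb the
    drift.\<close>
  define c where "c = (\<beta> - b) * (1 - b - \<beta>)"
  have c: "0 < c" using b \<beta> by (auto simp: c_def)
  have "((\<lambda>t. K * \<beta> * t) \<longlongrightarrow> K * \<beta> * 0) (at_right 0)"
    by (intro tendsto_intros)
  then have ev1: "\<forall>\<^sub>F t in at_right 0. K * \<beta> * t < c"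
    using c by (intro order_tendstoD) auto
  \<comment> \<open>Here the margin is
    \<open>1/4 - b = (b\<^sup>2 - b) - (b + 1/2) * (b - 1/2)\<close>, from the exponent
    \<open>b + 1/2\<close>. Relative to \<open>t powr (b - 3/2)\<close>, the drift acting on
    \<open>t powr b\<close> costs a factor \<open>sqrt t\<close>, and that acting on
    \<open>t powr (b + 1/2)\<close> a factor \<open>t\<close>.\<close>
  have "((\<lambda>t. K * \<bar>b\<bar> * sqrt t + K * \<bar>b + 1/2\<bar> * t) \<longlongrightarrow> K * \<bar>b\<bar> * sqrt 0 + K * \<bar>b + 1/2\<bar> * 0) (at_right 0)"
    by (intro tendsto_intros)
  then have ev2: "\<forall>\<^sub>F t in at_right 0. K * \<bar>b\<bar> * sqrt t + K * \<bar>b + 1/2\<bar> * t < 1/4 - b"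
    using b by (intro order_tendstoD) auto
  obtain e0 where e0: "0 < e0"
    "\<And>t. \<lbrakk>0 < t; t < e0\<rbrakk> \<Longrightarrow> K * \<beta> * t < c"
    "\<And>t. \<lbrakk>0 < t; t < e0\<rbrakk> \<Longrightarrow> K * \<bar>b\<bar> * sqrt t + K * \<bar>b + 1/2\<bar> * t < 1/4 - b"
    using eventually_conj[OF ev1 ev2] unfolding eventually_at_right_field by auto
  define e where "e = min e0 d / 2"
  have e: "0 < e" "e < d" "e < e0" using e0 d by (auto simp: e_def)
  \<comment> \<open>This choice makes the term with \<open>\<beta>\<close> alone match
    \<open>u\<close> at the right end \<open>e\<close>.\<close>
  define C where "C = u e / e powr \<beta>"
  have C: "0 \<le> C" using nonneg[of e] e by (auto simp: C_def)
  have "u t \<le> C * t powr \<beta>" if t: "0 < t" "t \<le> e" for t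
  proof -
    define W where "W s = s powr b + s powr (b + 1/2)" for s :: real
    have W0: "0 < W s" if "0 < s" for s using that by (auto simp: W_def add_pos_nonneg)
    have approx: "u t \<le> C * t powr \<beta> + \<epsilon> * W t" if \<epsilon>: "0 < \<epsilon>" for \<epsilon>
    proof -
      have "\<forall>\<^sub>F s in at_right 0. u s / s powr b < \<epsilon>"
        using order_tendstoD(2)[OF lim \<epsilon>] .
      then obtain l0 where l0: "0 < l0" "\<And>s. \<lbrakk>0 < s; s < l0\<rbrakk> \<Longrightarrow> u s / s powr b < \<epsilon>"
        unfolding eventually_at_right_field by auto
      \<comment> \<open>Only the left end depends on \<open>\<epsilon>\<close>; \<open>e\<close> and
        \<open>C\<close> do not, so at fixed \<open>t\<close> the limit \<open>\<epsilon>\<close> to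
        0 is harmless.\<close>
      define l where "l = min t (l0 / 2)"
      have l: "0 < l" "l \<le> t" "l < l0" using l0 t by (auto simp: l_def)
      \<comment> \<open>the term \<open>s\<^bsup>b + 1/2\<^esup>\<close> turns \<open>s\<^sup>b\<close> into a strict supersolution, absorbing \<open>a b s\<^bsup>b - 1\<^esup>\<close>\<close>
      define z where "z s = u s - (C * s powr \<beta> + \<epsilon> * (s powr b + s powr (b + 1/2)))" for s
      define z' where "z' s = u' s - (C * (\<beta> * s powr (\<beta> - 1))
        + \<epsilon> * (b * s powr (b - 1) + (b + 1/2) * s powr (b - 1/2)))" for s
      define z'' where "z'' s = u'' s - (C * (\<beta> * ((\<beta> - 1) * s powr (\<beta> - 2)))
        + \<epsilon> * (b * ((b - 1) * s powr (b - 2)) + (b + 1/2) * ((b - 1/2) * s powr (b - 3/2))))" for s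
      have "z t \<le> 0"
      proof (rule nonpos_of_no_positive_max[of l e z z' z''])
        show "(z has_real_derivative z' s) (at s)" if "l \<le> s" "s \<le> e" for s
          unfolding z_def z'_def using that l e
          by (auto intro!: derivative_eq_intros u simp: algebra_simps)
        show "(z' has_real_derivative z'' s) (at s)" if "l \<le> s" "s \<le> e" for s
          unfolding z'_def z''_def using that l e
          by (auto intro!: derivative_eq_intros u' simp: field_simps)
        have "u l \<le> \<epsilon> * l powr b"
          using l0(2)[of l] l by (simp add: field_simps)
        also have "\<dots> \<le> C * l powr \<beta> + \<epsilon> * (l powr b + l powr (b + 1/2))"
          using C \<epsilon> by (simp add: algebra_simps)
        finally show "z l \<le> 0" by (simp add: z_def)
        show "z e \<le> 0"
          using e \<epsilon> by (simp add: z_def C_def)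
        show "0 < z'' s" if s: "l < s" "s < e" "0 < z s" "z' s = 0" for s
        proof -
          have s0: "0 < s" "s < d" "s < e0" using s l e by auto
          \<comment> \<open>With \<open>P\<close>, \<open>Q\<close> and \<open>q\<close>, all powers
            of \<open>s\<close> become monomials, and the differential inequality becomes polynomial
            algebra.\<close>
          define P where "P = s powr (\<beta> - 2)"
          define Q where "Q = s powr (b - 2)"
          define q where "q = sqrt s"
          have PQ: "0 < P" "0 < Q" using s0 by (auto simp: P_def Q_def)
          have q: "q * q = s" "0 < q" using s0 by (auto simp: q_def)
          have qq: "q * (q * x) = s * x" for x
            using q(1) by (simp flip: mult.assoc)
          have s2: "s powr (x + 2) = s\<^sup>2 * s powr x" "s powr (x + 1) = s * s powr x"
            "s powr (x + 1/2) = q * s powr x" for x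
            using s0 by (simp_all add: powr_add powr_half_sqrt q_def)
          have e1: "s powr \<beta> = s\<^sup>2 * P" "s powr (\<beta> - 1) = s * P"
            using s2(1)[of "\<beta> - 2"] s2(2)[of "\<beta> - 2"] by (simp_all add: P_def)
          have e2: "s powr b = s\<^sup>2 * Q" "s powr (b - 1) = s * Q" "s powr (b - 3/2) = q * Q"
            using s2(1)[of "b - 2"] s2(2)[of "b - 2"] s2(3)[of "b - 2"] by (simp_all add: Q_def)
          have e3: "s powr (b + 1/2) = s\<^sup>2 * (q * Q)" "s powr (b - 1/2) = s * (q * Q)"
            using s2(1)[of "b - 3/2"] s2(2)[of "b - 3/2"] by (simp_all add: e2 add.commute)
          have u'eq: "u' s = C * (\<beta> * (s * P)) + \<epsilon> * (b * (s * Q) + (b + 1/2) * (s * (q * Q)))"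
            using s(4) unfolding z'_def e1 e2 e3 by simp
          have zs: "u s = z s + s\<^sup>2 * (C * P + \<epsilon> * (Q + q * Q))"
            unfolding z_def e1 e2 e3 by (simp add: algebra_simps)
          have z''eq: "z'' s = u'' s - (C * (\<beta> * ((\<beta> - 1) * P))
             + \<epsilon> * (b * ((b - 1) * Q) + (b + 1/2) * ((b - 1/2) * (q * Q))))"
            unfolding z''_def P_def[symmetric] Q_def[symmetric] e2 ..
          have A1: "a s * \<beta> * s \<le> K * \<beta> * s"
            using a[of s] s0 \<beta> by (intro mult_right_mono) auto
          have c1: "0 \<le> c - a s * \<beta> * s"
            using e0(2)[of s] s0 A1 by auto
          have aK: "a s * x \<le> K * \<bar>x\<bar>" for x
            using a[of s] s0 mult_right_mono[of "\<bar>a s\<bar>" K "\<bar>x\<bar>"] abs_ge_self[of "a s * x"]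
            by (simp add: abs_mult)
          have A2: "a s * b * q \<le> K * \<bar>b\<bar> * q" "a s * (b + 1/2) * s \<le> K * \<bar>b + 1/2\<bar> * s"
            using q s0 by (intro mult_right_mono aK; simp)+
          have c2: "0 \<le> 1/4 - b - a s * b * q - a s * (b + 1/2) * s"
            using e0(3)[OF s0(1,3)] A2 unfolding q_def[symmetric] by linarith
          \<comment> \<open>Splitting \<open>u\<close> into \<open>z\<close> plus barrier and
            replacing \<open>u'\<close> by the derivative of the barrier, as
            \<open>z' s = 0\<close>, leaves a positive term in \<open>z\<close>, because
            \<open>b\<^sup>2 - b > 0\<close>, and the two nonnegative margins.\<close>
          have "(b\<^sup>2 - b) / s\<^sup>2 * u s
              = (b\<^sup>2 - b) / s\<^sup>2 * z s + (b\<^sup>2 - b) * (C * P + \<epsilon> * (Q + q * Q))"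
            unfolding zs using s0 by (simp add: field_simps)
          moreover have "(b\<^sup>2 - b) / s\<^sup>2 * u s \<le> u'' s + a s * u' s"
            using sub s0 by blast
          ultimately have "(b\<^sup>2 - b) / s\<^sup>2 * z s + (C * P * (c - a s * \<beta> * s)
              + \<epsilon> * q * Q * (1/4 - b - a s * b * q - a s * (b + 1/2) * s)) \<le> z'' s"
            unfolding z''eq u'eq c_def
            by (simp add: algebra_simps power2_eq_square add_divide_distrib diff_divide_distrib qq)
          moreover have "0 < (b\<^sup>2 - b) / s\<^sup>2 * z s"
            using b s0 s(3) zero_le_power2[of b] by (intro mult_pos_pos divide_pos_pos zero_less_power) linarith+
          moreover have "0 \<le> C * P * (c - a s * \<beta> * s)"
            using C PQ c1 by simp
          moreover have "0 \<le> \<epsilon> * q * Q * (1/4 - b - a s * b * q - a s * (b + 1/2) * s)"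
            using \<epsilon> q PQ c2 by (intro mult_nonneg_nonneg) auto
          ultimately show ?thesis by linarith
        qed
        show "l \<le> t" "t \<le> e" using l t by auto
      qed
      then show ?thesis by (simp add: z_def W_def)
    qed
    show ?thesis
    proof (rule field_le_epsilon)
      fix \<eta> :: real assume "0 < \<eta>"
      then show "u t \<le> C * t powr \<beta> + \<eta>"
        using approx[of "\<eta> / W t"] W0[of t] t by simp
    qed
  qed
  with C e show ?thesis using that by blast
qed

section \<open>Vanishing by comparison with dead-core barriers\<close>

text \<open>The exponent \<open>2 / (1 - p)\<close> is the scaling at which \<open>y''\<close> and
  \<open>y powr p\<close> balance. A barrier centred at a point at distance \<open>\<tau>\<close>
  has size of order \<open>\<tau> powr (2 / (1 - p))\<close> at distance \<open>\<tau> / 2\<close>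
  from its centre, which beats the faster decay of \<open>u\<close>.\<close>

lemma dead_core:
  fixes u u' u'' a :: "real \<Rightarrow> real"
  assumes p: "0 < p" "p < 1" and d: "0 < d"
    and u: "\<And>t. \<lbrakk>0 < t; t < d\<rbrakk> \<Longrightarrow> (u has_real_derivative u' t) (at t)"
    and u': "\<And>t. \<lbrakk>0 < t; t < d\<rbrakk> \<Longrightarrow> (u' has_real_derivative u'' t) (at t)"
    and sub: "\<And>t. \<lbrakk>0 < t; t < d\<rbrakk> \<Longrightarrow> u t powr p \<le> u'' t + a t * u' t"
    and a: "\<And>t. \<lbrakk>0 < t; t < d\<rbrakk> \<Longrightarrow> \<bar>a t\<bar> \<le> K"
    and nonneg: "\<And>t. \<lbrakk>0 < t; t < d\<rbrakk> \<Longrightarrow> 0 \<le> u t"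
    and bound: "\<And>t. \<lbrakk>0 < t; t < d\<rbrakk> \<Longrightarrow> u t \<le> C * t powr \<beta>"
    and C: "0 \<le> C" and \<beta>: "2 / (1 - p) < \<beta>"
  obtains e where "0 < e" "\<And>t. \<lbrakk>0 < t; t < e\<rbrakk> \<Longrightarrow> u t = 0"
proof -
  have K: "0 \<le> K" using a[of "d/2"] d by auto
  \<comment> \<open>Half the critical exponent: the barrier is a \<open>q\<close>-th power of a
    squared distance.\<close>
  define q where "q = 1 / (1 - p)"
  have q: "1 < q" "q * (1 - p) = 1" "q * p = q - 1" "2 * q < \<beta>"
    using p \<beta> by (auto simp: q_def field_simps)
  \<comment> \<open>For \<open>w = A * Q powr q\<close> as below, \<open>w'' + a * w'\<close> is at
    most \<open>A * D * Q powr (q - 1)\<close>, where \<open>2 * q * (2 * q - 1)\<close> comes from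
    \<open>w''\<close> and \<open>2 * q * K\<close> from the drift. Since
    \<open>w powr p = A powr p * Q powr (q - 1)\<close>, the constant \<open>A\<close> is chosen to
    solve \<open>A * D = A powr p\<close>.\<close>
  define D where "D = 2 * q * (2 * q - 1 + K)"
  have D: "0 < D" using q K by (auto simp: D_def)
  define A where "A = (1 / D) powr q"
  have A: "0 < A" using D by (auto simp: A_def)
  have "A powr (1 - p) = 1 / D"
    using q D by (simp add: A_def powr_powr)
  then have AD: "A * D = A powr p"
    using A D by (simp add: powr_diff field_simps)
  \<comment> \<open>The surplus \<open>\<beta> - 2 * q > 0\<close> makes the bound on
    \<open>u\<close> at \<open>3 * \<tau> / 2\<close> smaller than the barrier at distance
    \<open>\<tau> / 2\<close> from its centre; hence the factors \<open>3/2\<close> and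
    \<open>1/4\<close>.\<close>
  have "((\<lambda>t. C * (3/2) powr \<beta> * t powr (\<beta> - 2 * q)) \<longlongrightarrow> C * (3/2) powr \<beta> * 0 powr (\<beta> - 2 * q)) (at_right 0)"
    using q by (intro tendsto_intros tendsto_powr') (auto simp: eventually_at_right_field intro!: exI[of _ 1])
  then have "\<forall>\<^sub>F t in at_right 0. C * (3/2) powr \<beta> * t powr (\<beta> - 2 * q) < A * (1/4) powr q"
    using A by (intro order_tendstoD) auto
  then obtain e0 where e0: "0 < e0"
    "\<And>t. \<lbrakk>0 < t; t < e0\<rbrakk> \<Longrightarrow> C * (3/2) powr \<beta> * t powr (\<beta> - 2 * q) < A * (1/4) powr q"
    unfolding eventually_at_right_field by auto
  \<comment> \<open>The bound \<open>d / 2\<close> keeps \<open>3 * \<tau> / 2\<close> below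
    \<open>d\<close>; the bound 1 gives \<open>\<bar>t - \<tau>\<bar> \<le> 1\<close> in the drift
    estimate.\<close>
  define e where "e = Min {e0, d / 2, 1}"
  have e: "0 < e" "e \<le> e0" "e \<le> d / 2" "e \<le> 1" using e0 d by (auto simp: e_def)
  have "u \<tau> = 0" if \<tau>: "0 < \<tau>" "\<tau> < e" for \<tau>
  proof -
    have small: "C * (3 * \<tau> / 2) powr \<beta> \<le> A * ((\<tau> / 2)\<^sup>2) powr q"
    proof -
      have "C * (3 * \<tau> / 2) powr \<beta> = C * (3/2) powr \<beta> * \<tau> powr (\<beta> - 2 * q) * \<tau> powr (2 * q)"
        using \<tau> powr_mult[of "3/2" \<tau> \<beta>] by (simp add: powr_add[symmetric])
      also have "\<dots> \<le> A * (1/4) powr q * \<tau> powr (2 * q)"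
        using e0(2)[of \<tau>] \<tau> e by (intro mult_right_mono) auto
      also have "\<tau> powr (2 * q) = (\<tau>\<^sup>2) powr q"
        using \<tau> by (simp add: powr_powr[symmetric])
      also have "A * (1/4) powr q * (\<tau>\<^sup>2) powr q = A * ((\<tau> / 2)\<^sup>2) powr q"
        using powr_mult[of "1/4" "\<tau>\<^sup>2" q] by (simp add: power2_eq_square)
      finally show ?thesis .
    qed
    have approx: "u \<tau> \<le> A * \<kappa> powr q" if \<kappa>: "0 < \<kappa>" for \<kappa>
    proof -
      \<comment> \<open>the shift \<open>\<kappa>\<close> makes the barrier \<open>A |t - \<tau>|\<^bsup>2 q\<^esup>\<close> smooth at \<open>\<tau>\<close>\<close>
      define Q where "Q t = (t - \<tau>)\<^sup>2 + \<kappa>" for t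
      have Q: "0 < Q t" for t using \<kappa> by (simp add: Q_def add_nonneg_pos)
      have dQ: "(Q has_real_derivative 2 * (t - \<tau>)) (at t)" for t
        unfolding Q_def by (auto intro!: derivative_eq_intros)
      define w where "w t = A * Q t powr q" for t
      define w' where "w' t = A * (q * (2 * (t - \<tau>)) * Q t powr (q - 1))" for t
      define w'' where "w'' t = A * (2 * q * Q t powr (q - 1)
          + q * (q - 1) * (2 * (t - \<tau>)) * (2 * (t - \<tau>)) * Q t powr (q - 2))" for t
      have w: "(w has_real_derivative w' t) (at t)" for t
        unfolding w_def w'_def using Q[of t]
        by (auto intro!: derivative_eq_intros dQ simp: algebra_simps)
      have w': "(w' has_real_derivative w'' t) (at t)" for t
        unfolding w'_def w''_def using Q[of t]
        by (auto intro!: derivative_eq_intros dQ simp: algebra_simps)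
      have "u \<tau> - w \<tau> \<le> 0"
      proof (rule nonpos_of_no_positive_max
            [of "\<tau> / 2" "3 * \<tau> / 2" "\<lambda>t. u t - w t" "\<lambda>t. u' t - w' t" "\<lambda>t. u'' t - w'' t"])
        fix t assume t: "\<tau> / 2 \<le> t" "t \<le> 3 * \<tau> / 2"
        then have t': "0 < t" "t < d" using \<tau> e by auto
        show "((\<lambda>t. u t - w t) has_real_derivative u' t - w' t) (at t)"
          "((\<lambda>t. u' t - w' t) has_real_derivative u'' t - w'' t) (at t)"
          using t' by (auto intro!: derivative_intros u u' w w')
      next
        have ends: "u t - w t \<le> 0" if t: "t = \<tau> / 2 \<or> t = 3 * \<tau> / 2" for t
        proof -
          have t': "0 < t" "t < d" "t \<le> 3 * \<tau> / 2" using t \<tau> e by auto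
          have "u t \<le> C * t powr \<beta>" using bound t' by auto
          also have "\<dots> \<le> C * (3 * \<tau> / 2) powr \<beta>"
            using t' C q by (intro mult_left_mono powr_mono2) auto
          also have "\<dots> \<le> A * ((\<tau> / 2)\<^sup>2) powr q" by (rule small)
          also have "t - \<tau> = \<tau> / 2 \<or> t - \<tau> = - (\<tau> / 2)" using t by auto
          then have "(\<tau> / 2)\<^sup>2 \<le> Q t"
            using \<kappa> unfolding Q_def by (metis less_eq_real_def less_add_same_cancel1 power2_minus)
          then have "A * ((\<tau> / 2)\<^sup>2) powr q \<le> w t"
            unfolding w_def using A q by (intro mult_left_mono powr_mono2) auto
          finally show ?thesis by simp
        qed
        show "u (\<tau> / 2) - w (\<tau> / 2) \<le> 0" "u (3 * \<tau> / 2) - w (3 * \<tau> / 2) \<le> 0"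
          using ends by auto
      next
        fix t assume t: "\<tau> / 2 < t" "t < 3 * \<tau> / 2" and z: "0 < u t - w t" "u' t - w' t = 0"
        have t': "0 < t" "t < d" "\<bar>t - \<tau>\<bar> \<le> 1" using t \<tau> e by auto
        define X where "X = Q t powr (q - 1)"
        have X: "0 < X" using Q[of t] by (simp add: X_def)
        have Xs: "(t - \<tau>)\<^sup>2 * Q t powr (q - 2) \<le> X"
        proof -
          have "X = Q t * Q t powr (q - 2)"
            using powr_add[of "Q t" 1 "q - 2"] Q[of t] by (simp add: X_def)
          moreover have "(t - \<tau>)\<^sup>2 * Q t powr (q - 2) \<le> Q t * Q t powr (q - 2)"
            using \<kappa> by (intro mult_right_mono) (auto simp: Q_def)
          ultimately show ?thesis by simp
        qed
        have "w'' t = A * (2 * q * X + 4 * q * (q - 1) * ((t - \<tau>)\<^sup>2 * Q t powr (q - 2)))"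
          by (simp add: w''_def X_def power2_eq_square algebra_simps)
        also have "\<dots> \<le> A * (2 * q * X + 4 * q * (q - 1) * X)"
          using A q by (intro mult_left_mono add_left_mono Xs) auto
        finally have w''le: "w'' t \<le> A * (2 * q * (2 * q - 1) * X)"
          by (simp add: algebra_simps)
        have "a t * (t - \<tau>) \<le> \<bar>a t\<bar> * \<bar>t - \<tau>\<bar>" by (metis abs_ge_self abs_mult)
        also have "\<dots> \<le> K * 1" using a[of t] t' K by (intro mult_mono) auto
        finally have "A * (2 * q * X) * (a t * (t - \<tau>)) \<le> A * (2 * q * X) * K"
          using A q X by (intro mult_left_mono) auto
        then have "a t * w' t \<le> A * (2 * q * X) * K"
          by (simp add: w'_def X_def algebra_simps)
        with w''le have "w'' t + a t * w' t \<le> A * D * X"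
          by (simp add: D_def algebra_simps)
        also have "\<dots> = w t powr p"
          using A q Q[of t] by (simp add: AD w_def X_def powr_mult powr_powr)
        \<comment> \<open>Monotonicity of the absorption term supplies the strict inequality
          wherever \<open>u\<close> exceeds the barrier.\<close>
        also have "\<dots> < u t powr p"
          using p z A Q[of t] by (intro powr_less_mono2) (auto simp: w_def)
        also have "\<dots> \<le> u'' t + a t * u' t" using sub t' by blast
        finally show "0 < u'' t - w'' t" using z(2) by simp
      qed (use \<tau> in auto)
      then show ?thesis by (simp add: w_def Q_def)
    qed
    have "u \<tau> \<le> 0"
    proof (rule field_le_epsilon)
      fix \<eta> :: real assume "0 < \<eta>"
      then show "u \<tau> \<le> 0 + \<eta>"
        using approx[of "(\<eta> / A) powr (1 / q)"] A q by (simp add: powr_powr)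
    qed
    with nonneg[of \<tau>] \<tau> e show ?thesis by auto
  qed
  with e that show ?thesis by blast
qed

section \<open>From the equation in space to the radial equation\<close>

text \<open>The sign \<open>\<sigma>\<close> treats both boundaries at once: -1 is the outer one, 1
  the inner one, and \<open>norm x = c + \<sigma> * \<delta> x\<close>. Regularity is given only for
  the function on space, so that of the profile \<open>u\<close> is recovered by restriction to a
  ray.\<close>

lemma radial_solution_ode:
  fixes \<delta> :: "'a::euclidean_space \<Rightarrow> real" and u :: "real \<Rightarrow> real"
  assumes \<sigma>: "\<sigma> = 1 \<or> \<sigma> = -1" and \<delta>: "\<delta> = (\<lambda>x. \<sigma> * (norm x - c))"
    and c: "0 < c" and d: "d \<le> \<delta>\<^sub>0" "d \<le> c"
    and sol: "nonneg_solution_on \<mu> p \<delta> {x. 0 < \<delta> x \<and> \<delta> x < \<delta>\<^sub>0} (\<lambda>x. u (\<delta> x))"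
    and t: "0 < t" "t < d"
  shows "0 \<le> u t"
    and "(u has_real_derivative deriv u t) (at t)"
    and "(deriv u has_real_derivative deriv (deriv u) t) (at t)"
    and "deriv (deriv u) t + \<sigma> * (DIM('a) - 1) / (c + \<sigma> * t) * deriv u t + \<mu> / t\<^sup>2 * u t = u t powr p"
proof -
  define G where "G b y = frechet_derivative (\<lambda>x. u (\<delta> x)) (at y) b" for b y
  have diff1: "(\<lambda>x. u (\<delta> x)) differentiable (at x)" if "0 < \<delta> x" "\<delta> x < d" for x
    using sol d that unfolding nonneg_solution_on_def twice_differentiable_on_def by auto
  have diff2: "G b differentiable (at x)" if "0 < \<delta> x" "\<delta> x < d" "b \<in> Basis" for x b
    using sol d that unfolding nonneg_solution_on_def twice_differentiable_on_def G_def[abs_def] by auto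
  obtain e :: 'a where e: "e \<in> Basis" using nonempty_Basis by blast
  define \<rho> where "\<rho> s = (c + \<sigma> * s) *\<^sub>R e" for s
  have pos: "0 < c + \<sigma> * s" if "0 < s" "s < d" for s
    using \<sigma> c d that by auto
  have norm_\<rho>: "norm (\<rho> s) = c + \<sigma> * s" if "0 < s" "s < d" for s
    using pos[OF that] e by (simp add: \<rho>_def)
  have \<delta>\<rho>: "\<delta> (\<rho> s) = s" if "0 < s" "s < d" for s
    using \<sigma> norm_\<rho>[OF that] by (auto simp: \<delta>)
  have d\<rho>: "\<rho> differentiable (at s)" for s
    unfolding \<rho>_def[abs_def] by (intro derivative_intros)
  have du: "(u has_real_derivative deriv u s) (at s)" if s: "0 < s" "s < d" for s
  proof -
    have "((\<lambda>x. u (\<delta> x)) \<circ> \<rho>) differentiable (at s)"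
      using diff1[of "\<rho> s"] \<delta>\<rho> s by (intro differentiable_chain_at d\<rho>) auto
    then obtain D where "((\<lambda>x. u (\<delta> x)) \<circ> \<rho> has_real_derivative D) (at s)"
      unfolding real_differentiable_def by blast
    then have "(u has_real_derivative D) (at s)"
      by (rule has_field_derivative_transform_within_open[of _ _ _ "{0<..<d}"]) (use s \<delta>\<rho> in auto)
    then show ?thesis using DERIV_imp_deriv by blast
  qed
  have dnorm: "(norm has_derivative (\<lambda>h. sgn x \<bullet> h)) (at x)" if "x \<noteq> 0" for x :: 'a
    using has_derivative_norm[OF that] by (simp add: inner_commute)
  have d\<delta>: "(\<delta> has_derivative (\<lambda>h. \<sigma> * (sgn x \<bullet> h))) (at x)" if "x \<noteq> 0" for x
    unfolding \<delta> using that by (auto intro!: derivative_eq_intros dnorm)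
  have G: "G b x = deriv u (\<delta> x) * (\<sigma> * (sgn x \<bullet> b))" if x: "0 < \<delta> x" "\<delta> x < d" for x b
  proof -
    have "x \<noteq> 0" using x d c \<sigma> by (auto simp: \<delta>)
    have "(u has_derivative (\<lambda>h. deriv u (\<delta> x) * h)) (at (\<delta> x))"
      using du[OF x] by (simp add: has_field_derivative_def)
    from has_derivative_compose[OF d\<delta>[OF \<open>x \<noteq> 0\<close>] this]
    show ?thesis unfolding G_def by (subst frechet_derivative_at[symmetric]) auto
  qed
  \<comment> \<open>Along the ray the unit radial vector is \<open>e\<close>, so
    \<open>\<sigma> * G e\<close> is the profile derivative there, because
    \<open>\<sigma> * \<sigma> = 1\<close>.\<close>
  have ddu: "(deriv u has_real_derivative deriv (deriv u) s) (at s)" if s: "0 < s" "s < d" for s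
  proof -
    have "(\<lambda>s. \<sigma> * (G e \<circ> \<rho>) s) differentiable (at s)"
      using diff2[of "\<rho> s"] \<delta>\<rho> s e by (intro derivative_intros differentiable_chain_at d\<rho>) auto
    then obtain D where "((\<lambda>s. \<sigma> * (G e \<circ> \<rho>) s) has_real_derivative D) (at s)"
      unfolding real_differentiable_def by blast
    then have "(deriv u has_real_derivative D) (at s)"
    proof (rule has_field_derivative_transform_within_open[of _ _ _ "{0<..<d}"])
      fix r assume "r \<in> {0<..<d}"
      then have r: "0 < r" "r < d" by auto
      then have "sgn (\<rho> r) \<bullet> e = 1"
        using pos[of r] e norm_\<rho>[of r] by (simp add: sgn_div_norm \<rho>_def inner_same_Basis)
      then show "\<sigma> * (G e \<circ> \<rho>) r = deriv u r"
        using G[of "\<rho> r" e] \<delta>\<rho>[of r] r \<sigma> by auto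
    qed (use s in auto)
    then show ?thesis using DERIV_imp_deriv by blast
  qed
  define x where "x = \<rho> t"
  have x: "\<delta> x = t" "norm x = c + \<sigma> * t" "x \<noteq> 0"
    using \<delta>\<rho>[of t] norm_\<rho>[of t] pos[of t] t by (auto simp: x_def)
  have "open {x. 0 < \<delta> x \<and> \<delta> x < d}"
    unfolding \<delta> by (intro open_Collect_conj open_Collect_less continuous_intros)
  \<comment> \<open>The diagonal Hessian entry splits into a radial part with \<open>u''\<close> and
    a tangential part with \<open>u' / norm x\<close>. As \<open>sgn x\<close> is a unit vector,
    summation over the basis leaves the factor \<open>DIM('a) - 1\<close> on the latter.\<close>
  have second: "frechet_derivative (G b) (at x) b
      = deriv (deriv u) t * (sgn x \<bullet> b)\<^sup>2 + \<sigma> / norm x * deriv u t * (1 - (sgn x \<bullet> b)\<^sup>2)"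
    if b: "b \<in> Basis" for b
  proof -
    have "(deriv u has_derivative (\<lambda>h. deriv (deriv u) t * h)) (at (\<delta> x))"
      using ddu[OF t] x by (simp add: has_field_derivative_def)
    note D = has_derivative_compose[OF d\<delta>[OF \<open>x \<noteq> 0\<close>] this]
    have "((\<lambda>y. deriv u (\<delta> y) * (\<sigma> * (y \<bullet> b / norm y))) has_derivative
        (\<lambda>h. deriv u (\<delta> x) * (\<sigma> * (((h \<bullet> b) * norm x - (x \<bullet> b) * (sgn x \<bullet> h)) / (norm x * norm x)))
           + deriv (deriv u) t * (\<sigma> * (sgn x \<bullet> h)) * (\<sigma> * (x \<bullet> b / norm x)))) (at x)"
      by (intro has_derivative_mult D has_derivative_mult_right has_derivative_divide' dnorm
          has_derivative_inner_left has_derivative_ident) (use x in auto)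
    then have "(G b has_derivative
        (\<lambda>h. deriv u (\<delta> x) * (\<sigma> * (((h \<bullet> b) * norm x - (x \<bullet> b) * (sgn x \<bullet> h)) / (norm x * norm x)))
           + deriv (deriv u) t * (\<sigma> * (sgn x \<bullet> h)) * (\<sigma> * (x \<bullet> b / norm x)))) (at x)"
    proof (rule has_derivative_transform_within_open[OF _ \<open>open _\<close>])
      show "deriv u (\<delta> y) * (\<sigma> * (y \<bullet> b / norm y)) = G b y" if "y \<in> {x. 0 < \<delta> x \<and> \<delta> x < d}" for y
        using G[of y b] that by (simp add: sgn_div_norm divide_inverse_commute)
    qed (use x t in auto)
    from frechet_derivative_at[OF this, symmetric] show ?thesis
      using \<sigma> b x(1,3) by (auto simp: inner_same_Basis sgn_div_norm power2_eq_square field_simps)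
  qed
  have "(\<Sum>b\<in>Basis. (sgn x \<bullet> b)\<^sup>2) = sgn x \<bullet> sgn x"
    by (simp add: euclidean_inner[of "sgn x" "sgn x"] power2_eq_square)
  also have "\<dots> = 1" using x(3) by (simp add: dot_square_norm norm_sgn)
  finally have sum1: "(\<Sum>b\<in>Basis. (sgn x \<bullet> b)\<^sup>2) = 1" .
  have "laplacian (\<lambda>x. u (\<delta> x)) x = (\<Sum>b\<in>Basis. frechet_derivative (G b) (at x) b)"
    by (simp add: laplacian_def G_def[abs_def])
  also have "\<dots> = deriv (deriv u) t + \<sigma> / norm x * deriv u t * (DIM('a) - 1)"
    by (simp add: second sum.distrib sum_subtractf sum1 flip: sum_distrib_left sum_divide_distrib)
  finally have lap: "laplacian (\<lambda>x. u (\<delta> x)) x = \<dots>" .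
  show "(u has_real_derivative deriv u t) (at t)" "(deriv u has_real_derivative deriv (deriv u) t) (at t)"
    using du ddu t by auto
  show "0 \<le> u t"
    using sol x t d unfolding nonneg_solution_on_def by force
  have "laplacian (\<lambda>x. u (\<delta> x)) x + \<mu> / (\<delta> x)\<^sup>2 * u (\<delta> x) = u (\<delta> x) powr p"
    using sol x t d unfolding nonneg_solution_on_def by force
  then show "deriv (deriv u) t + \<sigma> * (DIM('a) - 1) / (c + \<sigma> * t) * deriv u t + \<mu> / t\<^sup>2 * u t = u t powr p"
    unfolding lap x by (simp add: mult.commute mult.left_commute)
qed

section \<open>Choice of exponents and conclusion\<close>

theorem proposition2p4:
  fixes \<delta> :: "'a::euclidean_space \<Rightarrow> real"
    and u :: "real \<Rightarrow> real"
    and p \<mu> \<delta>\<^sub>0 :: real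
  assumes "0 < p" and "p < 1"
    and "\<mu> < - (2 * (p + 1) / (1 - p)\<^sup>2)"
    and "(\<exists>R>0. \<delta> = (\<lambda>x. R - norm x)) \<or> (\<exists>r\<^sub>0>0. \<delta> = (\<lambda>x. norm x - r\<^sub>0))"
    and "0 < \<delta>\<^sub>0"
    and "nonneg_solution_on \<mu> p \<delta> {x. 0 < \<delta> x \<and> \<delta> x < \<delta>\<^sub>0} (\<lambda>x. u (\<delta> x))"
    and "((\<lambda>t. u t / t powr beta_minus \<mu>) \<longlongrightarrow> 0) (at_right 0)"
  shows "\<exists>\<epsilon>>0. \<forall>x. 0 < \<delta> x \<and> \<delta> x < \<epsilon> \<longrightarrow> u (\<delta> x) = 0"
proof -
  obtain \<sigma> c :: real where \<sigma>: "\<sigma> = 1 \<or> \<sigma> = -1" and c: "0 < c"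
    and \<delta>: "\<delta> = (\<lambda>x. \<sigma> * (norm x - c))"
  proof -
    from assms(4) show ?thesis
    proof (elim disjE exE conjE)
      fix R :: real assume "0 < R" "\<delta> = (\<lambda>x. R - norm x)"
      then show ?thesis using that[of "-1" R] by auto
    next
      fix r\<^sub>0 :: real assume "0 < r\<^sub>0" "\<delta> = (\<lambda>x. norm x - r\<^sub>0)"
      then show ?thesis using that[of 1 r\<^sub>0] by auto
    qed
  qed
  \<comment> \<open>The bound \<open>c / 2\<close> keeps the radius at least \<open>c / 2\<close>,
    which bounds the drift by \<open>K\<close>.\<close>
  define d where "d = min \<delta>\<^sub>0 (c / 2)"
  have d: "0 < d" "d \<le> \<delta>\<^sub>0" "d \<le> c" "d \<le> c / 2" using assms(5) c by (auto simp: d_def)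
  define a where "a t = \<sigma> * (DIM('a) - 1) / (c + \<sigma> * t)" for t
  define K where "K = 2 * (DIM('a) - 1) / c"
  note ode = radial_solution_ode[OF \<sigma> \<delta> c d(2,3) assms(6)]
  have a: "\<bar>a t\<bar> \<le> K" if "0 < t" "t < d" for t
  proof -
    have "c / 2 \<le> c + \<sigma> * t" using \<sigma> d that c by auto
    then have "(real DIM('a) - 1) / (c + \<sigma> * t) \<le> (real DIM('a) - 1) / (c / 2)"
      using c by (intro divide_left_mono) (auto simp: DIM_ge_Suc0)
    moreover have "\<bar>a t\<bar> = (real DIM('a) - 1) / (c + \<sigma> * t)"
      using \<sigma> \<open>c / 2 \<le> c + \<sigma> * t\<close> c by (auto simp: a_def abs_mult DIM_ge_Suc0)
    ultimately show ?thesis by (simp add: K_def mult.commute)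
  qed
  define b where "b = beta_minus \<mu>"
  define \<alpha> where "\<alpha> = 2 / (1 - p)"
  have \<alpha>: "0 < \<alpha>" "\<alpha> * (\<alpha> - 1) = 2 * (p + 1) / (1 - p)\<^sup>2"
    using assms(1,2) by (auto simp: \<alpha>_def field_simps power2_eq_square)
  have "0 < 2 * (p + 1) / (1 - p)\<^sup>2" using assms(1,2) by auto
  then have "\<mu> < 0" using assms(3) by linarith
  then have "sqrt (1/4) < sqrt (1/4 - \<mu>)" by (intro real_sqrt_less_mono) auto
  then have b: "b < 0" by (simp add: b_def beta_minus_def real_sqrt_divide)
  have b\<mu>: "b\<^sup>2 - b = - \<mu>"
    using \<open>\<mu> < 0\<close> by (simp add: b_def beta_minus_def power2_diff algebra_simps power2_eq_square)
  \<comment> \<open>The product equals \<open>\<alpha> * (\<alpha> - 1) + \<mu>\<close>, so this is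
    exactly the hypothesis on \<open>\<mu>\<close>. As \<open>b < 0 < \<alpha>\<close>, it places
    \<open>\<alpha>\<close> below the larger root \<open>1 - b\<close>.\<close>
  have "(\<alpha> - b) * (\<alpha> + b - 1) < 0"
    using assms(3) \<alpha>(2) b\<mu> by (simp add: algebra_simps power2_eq_square)
  then have "\<alpha> < 1 - b" using \<alpha>(1) b by (simp add: mult_less_0_iff)
  then obtain \<beta> where \<beta>: "\<alpha> < \<beta>" "\<beta> < 1 - b" using dense by blast
  \<comment> \<open>Since \<open>\<mu> < 0\<close>, the terms
    \<open>- \<mu> / t\<^sup>2 * u t\<close> and \<open>u t powr p\<close> are both nonnegative.
    Dropping one or the other gives the linear inequality for the decay and the absorption
    inequality for the dead core.\<close>
  have super1: "(b\<^sup>2 - b) / t\<^sup>2 * u t \<le> deriv (deriv u) t + a t * deriv u t"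
    and super2: "u t powr p \<le> deriv (deriv u) t + a t * deriv u t" if t: "0 < t" "t < d" for t
  proof -
    have eq: "deriv (deriv u) t + a t * deriv u t = (b\<^sup>2 - b) / t\<^sup>2 * u t + u t powr p"
      using ode(4)[OF t] by (simp add: a_def b\<mu>)
    show "(b\<^sup>2 - b) / t\<^sup>2 * u t \<le> deriv (deriv u) t + a t * deriv u t"
      unfolding eq by simp
    show "u t powr p \<le> deriv (deriv u) t + a t * deriv u t"
      unfolding eq b\<mu> using \<open>\<mu> < 0\<close> ode(1)[OF t] by (simp add: divide_nonpos_nonneg mult_nonpos_nonneg)
  qed
  obtain C e where Ce: "0 \<le> C" "0 < e" "e < d" "\<And>t. \<lbrakk>0 < t; t \<le> e\<rbrakk> \<Longrightarrow> u t \<le> C * t powr \<beta>"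
    using bound_of_little_o_beta_minus[OF d(1) ode(2,3) super1 a ode(1) _ b _ \<beta>(2)]
      assms(7) \<beta> \<alpha> by (auto simp: b_def)
  obtain \<epsilon> where "0 < \<epsilon>" "\<And>t. \<lbrakk>0 < t; t < \<epsilon>\<rbrakk> \<Longrightarrow> u t = 0"
    using dead_core[of p e u "deriv u" "deriv (deriv u)" a K C \<beta>]
      assms(1,2) Ce ode super2 a \<beta>(1) by (auto simp: \<alpha>_def)
  then show ?thesis by blast
qed

end
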